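(* Let $q=p^s$ be a power of a prime $p$, and let $b,c$ be positive integers with $b'+c'=q^k$ for some positive integer $k$, where $b'=b/\gcd(b,c)$, $c'=c/\gcd(b,c)$. Then $(b,c;q)$ is admissible, and the threshold $n_0=n_0(b,c;q)$ satisfies $$\max\Big\{\frac{b}{q-1},\ \frac{b+c}{q}+k-1\Big\}\le n_0\le\frac{b+c-\gcd(b,c)}{q-1}.$$
   Context: The Hamming graph $H(n,q)$ has vertex set $\mathbb{Z}_q^n$, two vertices adjacent iff they differ in exactly one coordinate. A $(b,c)$-coloring of $H(n,q)$ is a surjective map onto $\{1,2\}$ in which each color-1 vertex has exactly $b$ neighbours of color 2 and each color-2 vertex has exactly $c$ neighbours of color 1. The parameters $(b,c;q)$ are admissible if a $(b,c)$-coloring of $H(n,q)$ exists for some $n$; in that case such colorings exist exactly for $n\ge n_0$ for some integer $n_0=n_0(b,c;q)$, called the threshold. *)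

theory Defs
  imports Complex_Main "HOL-Computational_Algebra.Primes"
begin

definition hamming_vertices :: "nat \<Rightarrow> nat \<Rightarrow> nat list set" where
  "hamming_vertices n q = {xs. length xs = n \<and> set xs \<subseteq> {..<q}}"

definition hamming_adj :: "nat list \<Rightarrow> nat list \<Rightarrow> bool" where
  "hamming_adj xs ys \<longleftrightarrow> length xs = length ys \<and>
     card {i. i < length xs \<and> xs ! i \<noteq> ys ! i} = 1"

definition bc_coloring :: "nat \<Rightarrow> nat \<Rightarrow> nat \<Rightarrow> nat \<Rightarrow> (nat list \<Rightarrow> nat) \<Rightarrow> bool" where
  "bc_coloring b c n q f \<longleftrightarrow>
     f ` hamming_vertices n q = {1, 2} \<and>
     (\<forall>x\<in>hamming_vertices n q. f x = 1 \<longrightarrow>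
        card {y\<in>hamming_vertices n q. hamming_adj x y \<and> f y = 2} = b) \<and>
     (\<forall>x\<in>hamming_vertices n q. f x = 2 \<longrightarrow>
        card {y\<in>hamming_vertices n q. hamming_adj x y \<and> f y = 1} = c)"

definition has_bc_coloring :: "nat \<Rightarrow> nat \<Rightarrow> nat \<Rightarrow> nat \<Rightarrow> bool" where
  "has_bc_coloring b c q n \<longleftrightarrow> (\<exists>f. bc_coloring b c n q f)"

definition admissible :: "nat \<Rightarrow> nat \<Rightarrow> nat \<Rightarrow> bool" where
  "admissible b c q \<longleftrightarrow> (\<exists>n. has_bc_coloring b c q n)"

text \<open>The threshold n_0(b,c;q): the least n for which a (b,c)-coloring of H(n,q) exists
  (for admissible parameters colorings exist exactly for n \<ge> n_0).\<close>
definition threshold :: "nat \<Rightarrow> nat \<Rightarrow> nat \<Rightarrow> nat" where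
  "threshold b c q = (LEAST n. has_bc_coloring b c q n)"

end

theory Submission
  imports Defs "Berlekamp_Zassenhaus.Finite_Field" "HOL-Algebra.Algebraic_Closure_Type"
begin

text \<open>Lower bound: giving the two colors the values \<open>b\<close> and \<open>- c\<close> turns a coloring into an
  eigenfunction of \<open>H(n,q)\<close> for the \<open>i\<close>-th eigenvalue, \<open>i = (b + c) / q\<close>. Such a function sums to zero
  over every face obtained by fixing fewer than \<open>i\<close> coordinates, so on a face of dimension \<open>n - i + 1\<close>
  color 1 has density \<open>c' / q^k\<close> in lowest terms. Hence \<open>q^k\<close> divides \<open>q^(n - i + 1)\<close>.

  Upper bound: repeat each coordinate of the \<open>q\<close>-ary Hamming code of redundancy \<open>k\<close> exactly
  \<open>gcd b c\<close> times. Every vertex then has \<open>gcd b c\<close> neighbours of each syndrome other than its own,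
  and one colors by membership of the syndrome in a set of \<open>c'\<close> out of the \<open>q^k\<close> syndromes.\<close>

hide_const (open) Divisibility.prime Polynomials.degree Polynomials.lead_coeff

section \<open>Neighbours and lines in the Hamming graph\<close>

lemma finite_hamming_vertices [simp]: "finite (hamming_vertices n q)"
  unfolding hamming_vertices_def
  using finite_lists_length_eq[of "{..<q}" n] by (simp add: conj_commute)

lemma hamming_vertices_update:
  "x \<in> hamming_vertices n q \<Longrightarrow> a < q \<Longrightarrow> x[l := a] \<in> hamming_vertices n q"
  using set_update_subset_insert[of x l a] by (auto simp: hamming_vertices_def)

lemma hamming_vertices_nth: "x \<in> hamming_vertices n q \<Longrightarrow> l < n \<Longrightarrow> x ! l < q"
  by (auto simp: hamming_vertices_def dest: nth_mem)

text \<open>A neighbour is determined by the coordinate that changes and its new value. Leaving out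
  the old value makes the parametrization injective, so neighbour counts and sums become iterated
  sums.\<close>

lemma bij_betw_hamming_neighbours:
  assumes "x \<in> hamming_vertices n q"
  shows "bij_betw (\<lambda>(l, a). x[l := a]) (SIGMA l:{..<n}. {..<q} - {x ! l})
           {y \<in> hamming_vertices n q. hamming_adj x y}"
proof (rule bij_betwI')
  have len: "length x = n" using assms by (simp add: hamming_vertices_def)
  fix u v assume u: "u \<in> (SIGMA l:{..<n}. {..<q} - {x ! l})"
    and v: "v \<in> (SIGMA l:{..<n}. {..<q} - {x ! l})"
  obtain l a l' a' where uv: "u = (l, a)" "v = (l', a')" by fastforce
  show "(case u of (l, a) \<Rightarrow> x[l := a]) = (case v of (l, a) \<Rightarrow> x[l := a]) \<longleftrightarrow> u = v"
  proof
    assume "(case u of (l, a) \<Rightarrow> x[l := a]) = (case v of (l, a) \<Rightarrow> x[l := a])"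
    then have eq: "x[l := a] = x[l' := a']" by (simp add: uv)
    have "l = l'"
      using arg_cong[OF eq, of "\<lambda>z. z ! l"] u by (cases "l = l'") (auto simp: uv len)
    moreover have "a = a'"
      using arg_cong[OF eq, of "\<lambda>z. z ! l"] u \<open>l = l'\<close> by (auto simp: uv len)
    ultimately show "u = v" by (simp add: uv)
  qed auto
next
  have len: "length x = n" using assms by (simp add: hamming_vertices_def)
  fix u assume u: "u \<in> (SIGMA l:{..<n}. {..<q} - {x ! l})"
  then obtain l a where la: "u = (l, a)" "l < n" "a < q" "a \<noteq> x ! l" by auto
  have "{i. i < length x \<and> x ! i \<noteq> x[l := a] ! i} = {l}"
    using la by (auto simp: len nth_list_update)
  then show "(case u of (l, a) \<Rightarrow> x[l := a]) \<in> {y \<in> hamming_vertices n q. hamming_adj x y}"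
    using la assms by (simp add: hamming_adj_def hamming_vertices_update)
next
  have len: "length x = n" using assms by (simp add: hamming_vertices_def)
  fix y assume y: "y \<in> {y \<in> hamming_vertices n q. hamming_adj x y}"
  then have leny: "length y = n" by (simp add: hamming_vertices_def)
  have "card {i. i < length x \<and> x ! i \<noteq> y ! i} = 1"
    using y unfolding hamming_adj_def by blast
  then obtain l where l: "{i. i < length x \<and> x ! i \<noteq> y ! i} = {l}"
    by (rule card_1_singletonE)
  have mem: "m < n \<and> x ! m \<noteq> y ! m \<longleftrightarrow> m = l" for m
    using l len by (simp add: set_eq_iff)
  then have l: "l < n" "y ! l \<noteq> x ! l" by metis+
  have yl: "y = x[l := y ! l]"
  proof (rule nth_equalityI)
    show "y ! m = x[l := y ! l] ! m" if "m < length y" for m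
      using mem[of m] that by (cases "m = l") (simp_all add: len leny)
  qed (simp add: len leny)
  show "\<exists>u\<in>SIGMA l:{..<n}. {..<q} - {x ! l}. y = (case u of (l, a) \<Rightarrow> x[l := a])"
  proof (rule bexI[of _ "(l, y ! l)"])
    show "y = (case (l, y ! l) of (l, a) \<Rightarrow> x[l := a])" using yl by simp
    show "(l, y ! l) \<in> (SIGMA l:{..<n}. {..<q} - {x ! l})"
      using l y hamming_vertices_nth[of y n q l] by simp
  qed
qed

lemma card_hamming_neighbours:
  assumes "x \<in> hamming_vertices n q"
  shows "card {y \<in> hamming_vertices n q. hamming_adj x y} = n * (q - 1)"
proof -
  have "card {y \<in> hamming_vertices n q. hamming_adj x y} =
      card (SIGMA l:{..<n}. {..<q} - {x ! l})"
    using bij_betw_same_card[OF bij_betw_hamming_neighbours[OF assms]] by simp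
  also have "\<dots> = (\<Sum>l<n. card ({..<q} - {x ! l}))"
    by simp
  also have "\<dots> = (\<Sum>l<n. q - 1)"
    using assms by (intro sum.cong) (auto simp: hamming_vertices_nth)
  finally show ?thesis by simp
qed

text \<open>Each of the \<open>n\<close> lines through \<open>x\<close> contains \<open>x\<close>
  itself once, which accounts for the subtracted term. Full lines are the form to which
  \<open>sum_line_swap\<close> applies.\<close>

lemma sum_hamming_neighbours:
  fixes g :: "nat list \<Rightarrow> int"
  assumes "x \<in> hamming_vertices n q"
  shows "(\<Sum>y | y \<in> hamming_vertices n q \<and> hamming_adj x y. g y) =
    (\<Sum>l<n. \<Sum>a<q. g (x[l := a])) - int n * g x"
proof -
  have "(\<Sum>y | y \<in> hamming_vertices n q \<and> hamming_adj x y. g y) =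
      (\<Sum>(l, a)\<in>(SIGMA l:{..<n}. {..<q} - {x ! l}). g (x[l := a]))"
    using sum.reindex_bij_betw[OF bij_betw_hamming_neighbours[OF assms], of g]
    by (simp add: case_prod_unfold)
  also have "\<dots> = (\<Sum>l<n. \<Sum>a\<in>{..<q} - {x ! l}. g (x[l := a]))"
    by (subst sum.Sigma) auto
  also have "\<dots> = (\<Sum>l<n. (\<Sum>a<q. g (x[l := a])) - g x)"
    using assms by (intro sum.cong) (auto simp: sum_diff1 hamming_vertices_nth)
  finally show ?thesis by (simp add: sum_subtractf)
qed

section \<open>Sums of eigenfunctions over faces\<close>

text \<open>Summation along lines in direction \<open>l\<close> is a self-adjoint operator: the
  involution \<open>(y, a)\<close> to \<open>(y[l := a], y ! l)\<close> exchanges the two ends of a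
  pair of points on a line.\<close>

lemma sum_line_swap:
  fixes h g :: "nat list \<Rightarrow> int"
  assumes "l < n"
  shows "(\<Sum>y\<in>hamming_vertices n q. \<Sum>a<q. h y * g (y[l := a])) =
    (\<Sum>y\<in>hamming_vertices n q. \<Sum>a<q. h (y[l := a]) * g y)"
  unfolding sum.cartesian_product
  by (rule sum.reindex_bij_witness[of _ "\<lambda>(y, a). (y[l := a], y ! l)" "\<lambda>(y, a). (y[l := a], y ! l)"])
     (use assms in \<open>auto simp: hamming_vertices_update hamming_vertices_nth\<close>,
      auto simp: hamming_vertices_def)

definition hamming_face :: "nat \<Rightarrow> nat \<Rightarrow> nat set \<Rightarrow> nat list \<Rightarrow> nat list set" where
  "hamming_face n q T x = {y \<in> hamming_vertices n q. \<forall>l\<in>T. y ! l = x ! l}"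

text \<open>Summing the eigenvalue equation over a face that fixes the coordinates in \<open>T\<close>, every
  direction outside \<open>T\<close> contributes \<open>q\<close> times the face sum, and every direction in \<open>T\<close>
  contributes the sum over a larger face, which vanishes by induction.\<close>

lemma face_sum_eigenfunction_zero:
  fixes g :: "nat list \<Rightarrow> int"
  assumes eig: "\<And>y. y \<in> hamming_vertices n q \<Longrightarrow>
      (\<Sum>z | z \<in> hamming_vertices n q \<and> hamming_adj y z. g z) =
      (int n * (int q - 1) - int q * int i) * g y"
    and "q > 0" and x: "x \<in> hamming_vertices n q"
    and "T \<subseteq> {..<n}" and "card T < i"
  shows "(\<Sum>y\<in>hamming_face n q T x. g y) = 0"
  using assms(4,5)
proof (induction "card T" arbitrary: T rule: less_induct)
  case less
  define V where "V = hamming_vertices n q"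
  \<comment> \<open>The face is encoded by its indicator on all of \<open>V\<close>, so that line
    sums can be moved from \<open>g\<close> to \<open>h\<close>.\<close>
  define h where "h = (\<lambda>T y. if \<forall>l\<in>T. y ! l = x ! l then 1 else 0 :: int)"
  define F where "F = (\<lambda>T. \<Sum>y\<in>V. h T y * g y)"
  have F: "(\<Sum>y\<in>hamming_face n q S x. g y) = F S" for S
    unfolding F_def hamming_face_def V_def
    by (intro sum.mono_neutral_cong_left) (auto simp: h_def)
  have fin: "finite T" using less.prems finite_subset by blast
  have lenV: "length y = n" if "y \<in> V" for y
    using that by (simp add: V_def hamming_vertices_def)
  have line: "(\<Sum>y\<in>V. \<Sum>a<q. h T y * g (y[l := a])) = (if l \<in> T then 0 else int q * F T)"
    if l: "l < n" for l
  proof (cases "l \<in> T")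
    case True
    \<comment> \<open>On the line through \<open>y\<close> in direction \<open>l\<close> only the
      point with value \<open>x ! l\<close> can meet the constraint at \<open>l\<close>; summing
      along the line therefore drops that constraint.\<close>
    have "(\<Sum>a<q. h T (y[l := a])) = h (T - {l}) y" if y: "y \<in> V" for y
    proof -
      have "(\<Sum>a<q. h T (y[l := a])) = (\<Sum>a<q. if a = x ! l then h (T - {l}) y else 0)"
        using True l lenV[OF y] by (intro sum.cong) (auto simp: h_def nth_list_update)
      also have "\<dots> = h (T - {l}) y"
        using hamming_vertices_nth[OF x l] by simp
      finally show ?thesis .
    qed
    then have "(\<Sum>y\<in>V. \<Sum>a<q. h T (y[l := a]) * g y) = F (T - {l})"
      by (simp add: F_def flip: sum_distrib_right)
    moreover have "card (T - {l}) < card T" using True fin by (intro card_Diff1_less)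
    then have "F (T - {l}) = 0"
      using less.hyps[of "T - {l}"] less.prems by (auto simp: F)
    ultimately show ?thesis using sum_line_swap[OF l, of "h T" g q] True by (simp add: V_def)
  next
    case False
    have "y[l := a] ! m = y ! m" if "m \<in> T" for y :: "nat list" and a m
      using False that by (metis nth_list_update_neq)
    then have "h T (y[l := a]) = h T y" for y a
      by (simp add: h_def)
    then show ?thesis
      using sum_line_swap[OF l, of "h T" g q] False by (simp add: V_def F_def sum_distrib_left)
  qed
  have "(int n * (int q - 1) - int q * int i) * F T =
      (\<Sum>y\<in>V. h T y * ((int n * (int q - 1) - int q * int i) * g y))"
    unfolding F_def sum_distrib_left by (simp only: mult_ac)
  also have "\<dots> = (\<Sum>y\<in>V. h T y * ((\<Sum>l<n. \<Sum>a<q. g (y[l := a])) - int n * g y))"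
    using eig sum_hamming_neighbours by (intro sum.cong) (auto simp: V_def)
  also have "\<dots> = (\<Sum>y\<in>V. \<Sum>l<n. \<Sum>a<q. h T y * g (y[l := a])) - int n * F T"
    by (simp add: F_def right_diff_distrib sum_distrib_left sum_subtractf mult_ac)
  also have "(\<Sum>y\<in>V. \<Sum>l<n. \<Sum>a<q. h T y * g (y[l := a])) =
      (\<Sum>l<n. \<Sum>y\<in>V. \<Sum>a<q. h T y * g (y[l := a]))"
    by (rule sum.swap)
  also have "\<dots> = (\<Sum>l<n. if l \<in> T then 0 else int q * F T)"
    by (intro sum.cong) (auto simp: line)
  also have "\<dots> = (\<Sum>l\<in>{..<n} - T. int q * F T)"
    by (intro sum.mono_neutral_cong_right) auto
  also have "\<dots> = (int n - int (card T)) * int q * F T"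
    using less.prems fin card_mono[of "{..<n}" T]
    by (simp add: card_Diff_subset of_nat_diff)
  \<comment> \<open>The terms in \<open>n\<close> cancel. Since \<open>card T < i\<close>, the
    remaining factor of \<open>F T\<close> is nonzero.\<close>
  finally have "int q * (int i - int (card T)) * F T = 0"
    by (auto simp: algebra_simps)
  then show ?case using \<open>q > 0\<close> less.prems by (simp add: F)
qed

lemma card_hamming_face_prefix:
  assumes x: "x \<in> hamming_vertices n q" and "j \<le> n"
  shows "card (hamming_face n q {..<j} x) = q ^ (n - j)"
proof -
  have len: "length x = n" using x by (simp add: hamming_vertices_def)
  have "bij_betw (\<lambda>z. take j x @ z) {z. set z \<subseteq> {..<q} \<and> length z = n - j}
      (hamming_face n q {..<j} x)"
  proof (rule bij_betw_byWitness[where f' = "drop j"])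
    show "\<forall>y\<in>hamming_face n q {..<j} x. take j x @ drop j y = y"
    proof
      fix y assume y: "y \<in> hamming_face n q {..<j} x"
      then have "take j x = take j y"
        using len \<open>j \<le> n\<close>
        by (intro nth_equalityI) (auto simp: hamming_face_def hamming_vertices_def)
      then show "take j x @ drop j y = y" by simp
    qed
    show "(\<lambda>z. take j x @ z) ` {z. set z \<subseteq> {..<q} \<and> length z = n - j} \<subseteq> hamming_face n q {..<j} x"
      using x \<open>j \<le> n\<close>
      by (auto simp: hamming_face_def hamming_vertices_def nth_append subset_iff dest!: in_set_takeD)
    show "drop j ` hamming_face n q {..<j} x \<subseteq> {z. set z \<subseteq> {..<q} \<and> length z = n - j}"
      using set_drop_subset[of j] by (fastforce simp: hamming_face_def hamming_vertices_def)
  qed (use len \<open>j \<le> n\<close> in auto)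
  from bij_betw_same_card[OF this] show ?thesis
    by (simp add: card_lists_length_eq)
qed

section \<open>Necessary conditions for a coloring\<close>

text \<open>One neighbour count is prescribed and the other is its complement in the degree
  \<open>M = n * (q - 1)\<close>. At color 1 the sum is
  \<open>b * (M - b) - c * b = (M - b - c) * b\<close>, and at color 2 it is
  \<open>b * c - c * (M - c) = (M - b - c) * (- c)\<close>.\<close>

lemma bc_coloring_eigenfunction:
  fixes f :: "nat list \<Rightarrow> nat" and b c :: nat
  defines "g \<equiv> \<lambda>x. if f x = 1 then int b else - int c"
  assumes col: "bc_coloring b c n q f" and x: "x \<in> hamming_vertices n q" and "q > 0"
  shows "(\<Sum>y | y \<in> hamming_vertices n q \<and> hamming_adj x y. g y) =
    (int n * (int q - 1) - int (b + c)) * g x"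
proof -
  define V where "V = hamming_vertices n q"
  define N where "N = (\<lambda>t. card {y \<in> V. hamming_adj x y \<and> f y = t})"
  have vals: "f y = 1 \<or> f y = 2" if "y \<in> V" for y
    using col that by (auto simp: bc_coloring_def V_def)
  have finV: "finite V" by (simp add: V_def)
  have split: "{y. y \<in> V \<and> hamming_adj x y} =
      {y \<in> V. hamming_adj x y \<and> f y = 1} \<union> {y \<in> V. hamming_adj x y \<and> f y = 2}"
    using vals by auto
  have "(\<Sum>y | y \<in> V \<and> hamming_adj x y. g y) =
      (\<Sum>y\<in>{y \<in> V. hamming_adj x y \<and> f y = 1}. g y) + (\<Sum>y\<in>{y \<in> V. hamming_adj x y \<and> f y = 2}. g y)"
    unfolding split using finV by (intro sum.union_disjoint) auto
  also have "\<dots> = int b * int (N 1) - int c * int (N 2)"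
    by (simp add: g_def N_def)
  finally have sum: "(\<Sum>y | y \<in> V \<and> hamming_adj x y. g y) = int b * int (N 1) - int c * int (N 2)" .
  have "N 1 + N 2 = card {y. y \<in> V \<and> hamming_adj x y}"
    unfolding split N_def using finV by (intro card_Un_disjoint[symmetric]) auto
  also have "\<dots> = n * (q - 1)"
    using card_hamming_neighbours[OF x] by (simp add: V_def)
  finally have "int (N 1) + int (N 2) = int n * (int q - 1)"
    using \<open>q > 0\<close> by (metis of_nat_add of_nat_mult of_nat_diff of_nat_1 Suc_leI One_nat_def)
  moreover have "f x = 1 \<Longrightarrow> N 2 = b" "f x = 2 \<Longrightarrow> N 1 = c"
    using col x by (auto simp: bc_coloring_def N_def V_def)
  ultimately have N: "int (N 1) + int (N 2) = int n * (int q - 1)"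
    "f x = 1 \<Longrightarrow> N 2 = b" "f x = 2 \<Longrightarrow> N 1 = c" by auto
  have "int b * int (N 1) - int c * int (N 2) = (int (N 1) + int (N 2) - int (b + c)) * g x"
    using vals[of x] x N(2,3) unfolding V_def[symmetric] g_def by (auto simp: algebra_simps)
  then have "int b * int (N 1) - int c * int (N 2) = (int n * (int q - 1) - int (b + c)) * g x"
    by (simp only: N(1))
  with sum show ?thesis by (simp add: V_def)
qed

text \<open>Some vertex has color 1, and its \<open>b\<close> neighbours of color 2 are among all
  its neighbours.\<close>

lemma bc_coloring_degree_bound:
  assumes col: "bc_coloring b c n q f" and "q > 0"
  shows "b \<le> n * (q - 1)"
proof -
  obtain x where x: "x \<in> hamming_vertices n q" "f x = 1"
    using col unfolding bc_coloring_def by (metis imageE insertI1)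
  then have "b = card {y \<in> hamming_vertices n q. hamming_adj x y \<and> f y = 2}"
    using col by (simp add: bc_coloring_def)
  also have "\<dots> \<le> card {y \<in> hamming_vertices n q. hamming_adj x y}"
    by (intro card_mono) auto
  finally show ?thesis using card_hamming_neighbours[OF x(1)] by simp
qed

lemma bc_coloring_correlation_bound:
  assumes col: "bc_coloring b c n q f" and "q > 1" "b > 0" "c > 0" "i > 0"
    and i: "b + c = q * i" and k: "b div gcd b c + c div gcd b c = q ^ k"
  shows "i + k \<le> n + 1"
proof -
  define g where "g = (\<lambda>x. if f x = 1 then int b else - int c)"
  obtain x where x: "x \<in> hamming_vertices n q" "f x = 1"
    using col unfolding bc_coloring_def by (metis imageE insertI1)
  have zero: "(\<Sum>y\<in>hamming_face n q {..<j} x. g y) = 0" if "j < i" "j \<le> n" for j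
  proof (rule face_sum_eigenfunction_zero)
    show "(\<Sum>z | z \<in> hamming_vertices n q \<and> hamming_adj y z. g z) =
      (int n * (int q - 1) - int q * int i) * g y" if "y \<in> hamming_vertices n q" for y
      using bc_coloring_eigenfunction[OF col that] \<open>q > 1\<close> i by (simp add: g_def flip: of_nat_mult)
  qed (use that x \<open>q > 1\<close> in auto)
  \<comment> \<open>Otherwise the sum would vanish even over the face with every coordinate fixed,
    which is the single vertex \<open>x\<close> of value \<open>b\<close>.\<close>
  have "i \<le> n"
  proof (rule ccontr)
    assume "\<not> i \<le> n"
    have "y = x" if "y \<in> hamming_face n q {..<n} x" for y
      using that x by (intro nth_equalityI) (auto simp: hamming_face_def hamming_vertices_def)
    then have "hamming_face n q {..<n} x = {x}"
      using x by (auto simp: hamming_face_def)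
    then show False using zero[of n] \<open>\<not> i \<le> n\<close> x \<open>b > 0\<close> by (simp add: g_def)
  qed
  \<comment> \<open>Fixing \<open>i - 1\<close> coordinates is the most for which the face sum is
    known to vanish; the smallest face gives the strongest divisibility.\<close>
  define A where "A = hamming_face n q {..<i - 1} x"
  have finA: "finite A" by (simp add: A_def hamming_face_def)
  define N1 where "N1 = card {y \<in> A. f y = 1}"
  define N2 where "N2 = card {y \<in> A. f y \<noteq> 1}"
  define d where "d = gcd b c"
  have d: "b = d * (b div d)" "c = d * (c div d)" "d > 0"
    using \<open>b > 0\<close> by (auto simp: d_def)
  have split: "A = {y \<in> A. f y = 1} \<union> {y \<in> A. f y \<noteq> 1}" by auto
  have "card A = N1 + N2"
    unfolding N1_def N2_def using finA by (subst split, intro card_Un_disjoint) auto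
  then have sum: "N1 + N2 = q ^ (n - (i - 1))"
    using card_hamming_face_prefix[OF x(1), of "i - 1"] \<open>i \<le> n\<close> by (simp add: A_def)
  have "(\<Sum>y\<in>A. g y) = (\<Sum>y\<in>{y \<in> A. f y = 1}. g y) + (\<Sum>y\<in>{y \<in> A. f y \<noteq> 1}. g y)"
    using finA by (subst split, intro sum.union_disjoint) auto
  also have "\<dots> = int b * int N1 - int c * int N2"
    by (simp add: g_def N1_def N2_def)
  finally have "b * N1 = c * N2"
    using zero[of "i - 1"] \<open>i \<le> n\<close> \<open>i > 0\<close> unfolding A_def[symmetric]
    by (simp flip: of_nat_mult)
  then have "d * ((b div d) * N1) = d * ((c div d) * N2)"
    using d by (metis mult.assoc)
  then have "(b div d) * N1 = (c div d) * N2" using d(3) by simp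
  then have "(b div d + c div d) * N1 = (c div d) * q ^ (n - (i - 1))"
    unfolding sum[symmetric] by (simp add: algebra_simps)
  then have "q ^ k dvd (c div d) * q ^ (n - (i - 1))"
    using k unfolding d_def by (metis dvd_triv_left)
  \<comment> \<open>Coprimality of the reduced parameters makes \<open>c div d\<close> coprime to
    their sum \<open>q ^ k\<close>, so it can be cancelled from the divisibility.\<close>
  moreover have "coprime (b div d) (c div d)"
    unfolding d_def using \<open>b > 0\<close> by (intro div_gcd_coprime) auto
  then have "coprime (q ^ k) (c div d)"
    unfolding k[folded d_def, symmetric] by (simp add: coprime_iff_gcd_eq_1)
  ultimately have "q ^ k dvd q ^ (n - (i - 1))"
    by (simp add: coprime_dvd_mult_right_iff)
  then have "k \<le> n - (i - 1)"
    using \<open>q > 1\<close> by (simp add: dvd_power_iff_le)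
  then show ?thesis using \<open>i \<le> n\<close> \<open>i > 0\<close> by simp
qed

section \<open>Finite subfields and coset representatives\<close>

text \<open>The fixed points, which form the subfield GF(q), are the roots of
  \<open>X^q - X\<close>. This polynomial splits into linear factors, and its derivative is
  \<open>-1\<close> because \<open>q\<close> vanishes in the field; a double root would be a root of
  the derivative, so there are \<open>q\<close> distinct roots.\<close>

lemma card_power_fixed_points:
  assumes "prime CHAR('a :: alg_closed_field)" and "r > 0" and q: "q = CHAR('a) ^ r"
  shows "card {x :: 'a. x ^ q = x} = q"
proof -
  have "q > 1" using assms prime_gt_1_nat[OF assms(1)] by (metis one_less_power)
  define P :: "'a poly" where "P = monom 1 q - monom 1 1"
  have "coeff P q = 1" using \<open>q > 1\<close> by (simp add: P_def)
  moreover have "degree P \<le> q"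
    unfolding P_def using \<open>q > 1\<close> by (intro degree_diff_le) (auto simp: degree_monom_eq)
  ultimately have degP: "degree P = q" using le_degree[of P q] by simp
  have P: "poly P x = x ^ q - x" for x by (simp add: P_def poly_monom)
  obtain A where A: "size A = degree P" "P = smult (lead_coeff P) (\<Prod>x\<in>#A. [:-x, 1:])"
    using alg_closed_imp_factorization[of P] \<open>coeff P q = 1\<close> by force
  then have PA: "P = (\<Prod>x\<in>#A. [:-x, 1:])" using \<open>coeff P q = 1\<close> degP by simp
  have "poly P x = 0 \<longleftrightarrow> x \<in># A" for x
    unfolding PA by (induction A) auto
  then have roots: "{x. x ^ q = x} = set_mset A" by (auto simp: P)
  have "of_nat q = (0 :: 'a)"
    unfolding of_nat_eq_0_iff_char_dvd q using \<open>r > 0\<close> by simp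
  then have deriv: "pderiv P = - 1"
    by (simp add: P_def pderiv_diff pderiv_monom)
  have "count A x = 1" if xA: "x \<in># A" for x
  proof (rule ccontr)
    assume "count A x \<noteq> 1"
    obtain B where B: "A = add_mset x B" using multi_member_split[OF xA] by blast
    with \<open>count A x \<noteq> 1\<close> have "count B x > 0" by simp
    then have "x \<in># B" by (simp only: count_greater_zero_iff)
    from multi_member_split[OF this] obtain C where C: "B = add_mset x C" by blast
    have "P = [:-x, 1:] * ([:-x, 1:] * (\<Prod>y\<in>#C. [:-y, 1:]))"
      unfolding PA B C by (simp only: image_mset_add_mset prod_mset.add_mset)
    then have "poly (pderiv P) x = 0" by (simp only: pderiv_mult) simp
    then show False by (simp add: deriv)
  qed
  then have "size A = card (set_mset A)" by (simp add: size_multiset_overloaded_eq)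
  then show ?thesis unfolding roots using A(1) degP by simp
qed

text \<open>Additivity of the Frobenius power, applied to \<open>(x - y) + y\<close>, avoids a
  discussion of the sign of \<open>(-1)^q\<close>.\<close>

lemma power_fixed_points_diff:
  fixes x y :: "'a :: field"
  assumes "prime CHAR('a)" "q = CHAR('a) ^ r" "x ^ q = x" "y ^ q = y"
  shows "(x - y) ^ q = x - y"
  using freshmans_dream'[OF assms(1,2), of "x - y" y] assms(3,4) by (simp add: eq_diff_eq)

text \<open>Multiplication by \<open>F\<close> partitions \<open>E\<close> into the cosets
  \<open>C e\<close>, and \<open>R\<close> takes one element of each. For the unit groups of GF(q^k)
  and GF(q), \<open>R\<close> represents the one-dimensional subspaces.\<close>

lemma exists_coset_transversal:
  fixes E F :: "'a :: field set"
  assumes "1 \<in> F" "0 \<notin> F" "0 \<notin> E"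
    and mult: "\<And>x y. x \<in> F \<Longrightarrow> y \<in> F \<Longrightarrow> x * y \<in> F"
    and inv: "\<And>x. x \<in> F \<Longrightarrow> inverse x \<in> F"
    and act: "\<And>e x. e \<in> E \<Longrightarrow> x \<in> F \<Longrightarrow> e * x \<in> E"
  obtains R where "R \<subseteq> E" "bij_betw (\<lambda>(r, x). r * x) (R \<times> F) E"
proof -
  define C where "C = (\<lambda>e. (\<lambda>x. e * x) ` F)"
  \<comment> \<open>The choice depends only on the set \<open>C e\<close>, so elements of the same
    coset share their representative.\<close>
  define rep where "rep = (\<lambda>e. SOME r. r \<in> C e)"
  have C_sub: "C (e * x) \<subseteq> C e" if "x \<in> F" for e x
    using that mult by (auto simp: C_def mult.assoc)
  have C_mult: "C (e * x) = C e" if "x \<in> F" for e x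
  proof
    have "x \<noteq> 0" using that \<open>0 \<notin> F\<close> by auto
    then have "e * x * inverse x = e" by (simp add: mult.assoc)
    then show "C e \<subseteq> C (e * x)" using C_sub[OF inv[OF that], of "e * x"] by (simp only:)
  qed (rule C_sub[OF that])
  have "e \<in> C e" for e using \<open>1 \<in> F\<close> by (force simp: C_def)
  then have rep: "rep e \<in> C e" for e unfolding rep_def by (metis someI)
  have rep_mult: "rep (e * x) = rep e" if "x \<in> F" for e x
    by (simp add: rep_def C_mult that)
  have rep_rep: "rep (rep e) = rep e" for e
    using rep[of e] rep_mult by (auto simp: C_def)
  have rep_E: "rep e \<in> E" if "e \<in> E" for e using rep[of e] that act by (auto simp: C_def)
  have "bij_betw (\<lambda>(r, x). r * x) (rep ` E \<times> F) E"
  proof (rule bij_betw_imageI)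
    show "inj_on (\<lambda>(r, x). r * x) (rep ` E \<times> F)"
    proof (rule inj_onI, clarify)
      fix e x e' x' assume *: "e \<in> E" "x \<in> F" "e' \<in> E" "x' \<in> F" "rep e * x = rep e' * x'"
      have "rep e = rep (rep e * x)" using *(2) by (simp add: rep_mult rep_rep)
      also have "\<dots> = rep e'" unfolding *(5) using *(4) by (simp add: rep_mult rep_rep)
      finally have "rep e = rep e'" .
      moreover have "rep e \<noteq> 0"
        using rep_E[OF *(1)] \<open>0 \<notin> E\<close> by metis
      ultimately show "rep e = rep e' \<and> x = x'" using * by simp
    qed
    have "\<exists>x\<in>F. e = rep e * x" for e
    proof -
      obtain x where "x \<in> F" "rep e = e * x" using rep[of e] by (auto simp: C_def)
      moreover from this have "x \<noteq> 0" using \<open>0 \<notin> F\<close> by auto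
      ultimately show ?thesis by (intro bexI[of _ "inverse x"]) (simp_all add: inv mult.assoc)
    qed
    then show "(\<lambda>(r, x). r * x) ` (rep ` E \<times> F) = E"
      using act rep_E by (force simp: image_iff)
  qed
  moreover have "rep ` E \<subseteq> E" using rep_E by blast
  ultimately show ?thesis using that by blast
qed

section \<open>Labellings by syndromes and their merging into two colors\<close>

text \<open>A perfect coloring whose quotient matrix has all off-diagonal entries equal to
  \<open>d\<close>; the diagonal entry follows from the degree of the graph.\<close>

definition uniform_labelling ::
  "nat \<Rightarrow> nat \<Rightarrow> nat \<Rightarrow> nat \<Rightarrow> (nat list \<Rightarrow> nat) \<Rightarrow> bool" where
  "uniform_labelling n q N d \<sigma> \<longleftrightarrow>
     \<sigma> ` hamming_vertices n q \<subseteq> {..<N} \<and>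
     (\<forall>x\<in>hamming_vertices n q. \<forall>t<N. t \<noteq> \<sigma> x \<longrightarrow>
        card {y \<in> hamming_vertices n q. hamming_adj x y \<and> \<sigma> y = t} = d)"

text \<open>The indices below \<open>d * m\<close> run through the residues \<open>d\<close> times,
  and \<open>l div m\<close> numbers the rounds. It counts how often a column of the check matrix is
  repeated.\<close>

lemma card_mod_eq_fibre:
  assumes "j < (m :: nat)"
  shows "card {l \<in> {..<d * m}. l mod m = j} = d"
proof -
  have "bij_betw (\<lambda>i. i * m + j) {..<d} {l \<in> {..<d * m}. l mod m = j}"
  proof (rule bij_betw_byWitness[where f' = "\<lambda>l. l div m"])
    have "i * m + j < d * m" if "i < d" for i
    proof -
      have "i * m + j < Suc i * m" using assms by simp
      also have "\<dots> \<le> d * m" using that by (intro mult_right_mono) auto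
      finally show ?thesis .
    qed
    then show "(\<lambda>i. i * m + j) ` {..<d} \<subseteq> {l \<in> {..<d * m}. l mod m = j}"
      using assms by auto
  qed (use assms in \<open>auto simp: less_mult_imp_div_less\<close>)
  from bij_betw_same_card[OF this] show ?thesis by simp
qed

text \<open>The labels are the syndromes of the \<open>d\<close>-fold repetition of the Hamming code: the columns of
  its check matrix represent the one-dimensional \<open>GF(q)\<close>-subspaces of \<open>GF(q^k)\<close>, each \<open>d\<close> times.\<close>

lemma uniform_labelling_alg_closed_field:
  assumes p: "prime CHAR('a :: alg_closed_field)" and "s > 0" "k > 0"
    and q: "q = CHAR('a) ^ s"
  shows "\<exists>\<sigma>. uniform_labelling (d * ((q ^ k - 1) div (q - 1))) q (q ^ k) d \<sigma>"
proof -
  define Q where "Q = q ^ k"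
  have Q: "Q = CHAR('a) ^ (s * k)" by (simp add: Q_def q power_mult)
  have "q > 1" unfolding q using \<open>s > 0\<close> by (intro one_less_power prime_gt_1_nat[OF p])
  then have "Q > 1" using \<open>k > 0\<close> by (metis Q_def one_less_power)
  \<comment> \<open>\<open>F\<close> and \<open>E\<close> are GF(q) and GF(q^k), realized as fixed
    points of Frobenius powers inside one algebraically closed field.\<close>
  define F where "F = {x :: 'a. x ^ q = x}"
  define E where "E = {x :: 'a. x ^ Q = x}"
  have cardF: "card F = q" and cardE: "card E = Q"
    unfolding F_def E_def using p \<open>s > 0\<close> \<open>k > 0\<close> q Q by (intro card_power_fixed_points; simp)+
  then have finF: "finite F" and finE: "finite E"
    using \<open>q > 1\<close> \<open>Q > 1\<close> by (metis card.infinite not_one_less_zero)+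
  have FE: "F \<subseteq> E"
  proof
    fix x assume x: "x \<in> F"
    have "x ^ (q ^ j) = x" for j
      by (induction j) (use x in \<open>simp_all add: F_def power_mult\<close>)
    then show "x \<in> E" by (simp add: E_def Q_def)
  qed
  have E_mult: "x * y \<in> E" if "x \<in> E" "y \<in> E" for x y
    using that by (simp add: E_def power_mult_distrib)
  have E_diff: "x - y \<in> E" if "x \<in> E" "y \<in> E" for x y
    using that power_fixed_points_diff[OF p Q] by (simp add: E_def)
  have F_diff: "x - y \<in> F" if "x \<in> F" "y \<in> F" for x y
    using that power_fixed_points_diff[OF p q] by (simp add: F_def)
  have "0 \<in> F" using \<open>q > 1\<close> by (simp add: F_def)
  then have F_add: "x + y \<in> F" if "x \<in> F" "y \<in> F" for x y
    using F_diff[of x "0 - y"] F_diff[of 0 y] that by simp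
  have "0 \<in> E" using \<open>Q > 1\<close> by (simp add: E_def)
  \<comment> \<open>\<open>R\<close> supplies the columns of the check matrix: every nonzero
    syndrome is a unique column times a unique nonzero scalar.\<close>
  obtain R where R: "R \<subseteq> E - {0}" "bij_betw (\<lambda>(r, x). r * x) (R \<times> (F - {0})) (E - {0})"
  proof (rule exists_coset_transversal[of "F - {0}" "E - {0}"])
    show "e * x \<in> E - {0}" if "e \<in> E - {0}" "x \<in> F - {0}" for e x
      using that FE E_mult by auto
  qed (auto simp: F_def power_mult_distrib power_inverse)
  define m where "m = card R"
  have "m * (q - 1) = Q - 1"
    using bij_betw_same_card[OF R(2)] finF finE \<open>0 \<in> F\<close> \<open>0 \<in> E\<close>
    by (simp add: card_cartesian_product m_def cardF cardE)
  then have m: "m = (Q - 1) div (q - 1)" using \<open>q > 1\<close>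
    by (metis nonzero_mult_div_cancel_right zero_less_diff less_numeral_extra(3))
  have "finite R" using R(1) finE finite_subset by blast
  \<comment> \<open>Three numberings: \<open>\<rho>\<close> of the columns, \<open>\<phi>\<close> of
    the scalars by the symbols below \<open>q\<close>, and \<open>\<psi>\<close> from syndromes to
    labels. Arbitrary bijections suffice, since only differences of scalars and equality of
    syndromes matter.\<close>
  obtain \<rho> where \<rho>: "bij_betw \<rho> {..<m} R"
    using ex_bij_betw_nat_finite[OF \<open>finite R\<close>] by (auto simp: m_def atLeast0LessThan)
  obtain \<phi> where \<phi>: "bij_betw \<phi> {..<q} F"
    using ex_bij_betw_nat_finite[OF finF] by (auto simp: cardF atLeast0LessThan)
  obtain \<psi> where \<psi>: "bij_betw \<psi> E {..<Q}"
    using ex_bij_betw_finite_nat[OF finE] by (auto simp: cardE atLeast0LessThan)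
  define n where "n = d * m"
  define V where "V = hamming_vertices n q"
  define h where "h = (\<lambda>l. \<rho> (l mod m))"
  define S where "S = (\<lambda>x. \<Sum>l<n. h l * \<phi> (x ! l))"
  have hR: "h l \<in> R" if "l < n" for l
  proof -
    have "m > 0" using that by (cases m) (auto simp: n_def)
    then show ?thesis using \<rho> by (auto simp: h_def bij_betw_def)
  qed
  have \<phi>F: "\<phi> a \<in> F" if "a < q" for a
    using \<phi> that by (auto simp: bij_betw_def)
  have SE: "S x \<in> E" if "x \<in> V" for x
  proof -
    have "h l * \<phi> (x ! l) \<in> E" if "l < n" for l
      using hR[OF that] R(1) FE \<phi>F hamming_vertices_nth[of x n q l] that \<open>x \<in> V\<close>
      by (intro E_mult) (auto simp: V_def)
    then have "(\<Sum>l<n. (h l * \<phi> (x ! l)) ^ Q) = S x"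
      unfolding S_def by (intro sum.cong) (auto simp: E_def)
    moreover have "S x ^ Q = (\<Sum>l<n. (h l * \<phi> (x ! l)) ^ Q)"
      unfolding S_def by (rule freshmans_dream_sum'[OF p Q])
    ultimately show ?thesis by (simp add: E_def)
  qed
  have S_update: "S (x[l := a]) = S x + h l * (\<phi> a - \<phi> (x ! l))" if "x \<in> V" "l < n" for x l a
  proof -
    have len: "length x = n" using that by (simp add: V_def hamming_vertices_def)
    have "S (x[l := a]) - S x = (\<Sum>j<n. if j = l then h l * (\<phi> a - \<phi> (x ! l)) else 0)"
      unfolding S_def sum_subtractf[symmetric]
      by (intro sum.cong) (auto simp: len nth_list_update algebra_simps)
    then show ?thesis using that by (simp add: algebra_simps)
  qed
  have "card {y \<in> V. hamming_adj x y \<and> \<psi> (S y) = t} = d"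
    if x: "x \<in> V" and t: "t < Q" "t \<noteq> \<psi> (S x)" for x t
  proof -
    obtain w where w: "w \<in> E" "\<psi> w = t"
      using \<psi> t(1) unfolding bij_betw_def by (metis imageE lessThan_iff)
    define e where "e = w - S x"
    have "e \<in> E - {0}" using w t(2) SE[OF x] E_diff by (auto simp: e_def)
    then have "e \<in> (\<lambda>(r, x). r * x) ` (R \<times> (F - {0}))"
      using R(2) by (simp add: bij_betw_def)
    then obtain r u where ru: "r \<in> R" "u \<in> F - {0}" "e = r * u" by auto
    have unique: "r' = r \<and> u' = u" if "r' \<in> R" "u' \<in> F - {0}" "r' * u' = e" for r' u'
      using inj_onD[OF bij_betw_imp_inj_on[OF R(2)], of "(r', u')" "(r, u)"] that ru by auto
    have hit: "\<psi> (S (x[l := a])) = t \<longleftrightarrow> h l = r \<and> \<phi> a = \<phi> (x ! l) + u"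
      if l: "l < n" and a: "a < q" "a \<noteq> x ! l" for l a
    proof -
      have xl: "x ! l < q" using x l by (simp add: V_def hamming_vertices_nth)
      have "\<phi> a \<noteq> \<phi> (x ! l)"
        using \<phi> a xl unfolding bij_betw_def inj_on_def by blast
      then have diff: "\<phi> a - \<phi> (x ! l) \<in> F - {0}"
        using F_diff[OF \<phi>F[OF a(1)] \<phi>F[OF xl]] by simp
      have "S (x[l := a]) \<in> E"
        using SE x a hamming_vertices_update by (auto simp: V_def)
      then have "\<psi> (S (x[l := a])) = t \<longleftrightarrow> S (x[l := a]) = w"
        using \<psi> w unfolding bij_betw_def inj_on_def by blast
      also have "\<dots> \<longleftrightarrow> h l * (\<phi> a - \<phi> (x ! l)) = e"
        unfolding S_update[OF x l] e_def by (simp only: eq_diff_eq add.commute)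
      also have "\<dots> \<longleftrightarrow> h l = r \<and> \<phi> a - \<phi> (x ! l) = u"
        using unique[OF hR[OF l] diff] ru(3) by auto
      finally show ?thesis by (auto simp: algebra_simps)
    qed
    define Y where "Y = (SIGMA l:{..<n}. {..<q} - {x ! l})"
    have bij: "bij_betw (\<lambda>(l, a). x[l := a]) Y {y \<in> V. hamming_adj x y}"
      using bij_betw_hamming_neighbours[of x n q] x by (simp add: V_def Y_def)
    have "bij_betw (\<lambda>(l, a). x[l := a]) {(l, a) \<in> Y. \<psi> (S (x[l := a])) = t}
        {y \<in> V. hamming_adj x y \<and> \<psi> (S y) = t}"
    proof (rule bij_betw_subset[OF bij])
      have "{y \<in> V. hamming_adj x y \<and> \<psi> (S y) = t} =
          {y \<in> (\<lambda>(l, a). x[l := a]) ` Y. \<psi> (S y) = t}"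
        using bij by (auto simp: bij_betw_def)
      then show "(\<lambda>(l, a). x[l := a]) ` {(l, a) \<in> Y. \<psi> (S (x[l := a])) = t} =
          {y \<in> V. hamming_adj x y \<and> \<psi> (S y) = t}" by auto
    qed auto
    from bij_betw_same_card[OF this]
    have "card {y \<in> V. hamming_adj x y \<and> \<psi> (S y) = t} =
        card {(l, a) \<in> Y. \<psi> (S (x[l := a])) = t}" by simp
    also have "{(l, a) \<in> Y. \<psi> (S (x[l := a])) = t} =
        {(l, a) \<in> Y. h l = r \<and> \<phi> a = \<phi> (x ! l) + u}"
      using hit by (auto simp: Y_def)
    also have "card \<dots> = card {l \<in> {..<n}. h l = r}"
    proof (rule bij_betw_same_card[of fst], rule bij_betw_imageI)
      show "inj_on fst {(l, a) \<in> Y. h l = r \<and> \<phi> a = \<phi> (x ! l) + u}"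
        using \<phi> unfolding bij_betw_def inj_on_def Y_def by auto
      have "\<exists>a. (l, a) \<in> Y \<and> \<phi> a = \<phi> (x ! l) + u" if l: "l < n" for l
      proof -
        have "x ! l < q" using x l by (simp add: V_def hamming_vertices_nth)
        then have "\<phi> (x ! l) + u \<in> F" using F_add \<phi>F ru(2) by auto
        then obtain a where "a < q" "\<phi> a = \<phi> (x ! l) + u"
          using \<phi> unfolding bij_betw_def by (metis imageE lessThan_iff)
        then show ?thesis using l ru(2) by (auto simp: Y_def)
      qed
      then show "fst ` {(l, a) \<in> Y. h l = r \<and> \<phi> a = \<phi> (x ! l) + u} = {l \<in> {..<n}. h l = r}"
        by (force simp: Y_def)
    qed
    also have "{l \<in> {..<n}. h l = r} = {l \<in> {..<d * m}. l mod m = the_inv_into {..<m} \<rho> r}"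
    proof -
      have "m > 0" using ru(1) \<open>finite R\<close> by (auto simp: m_def card_gt_0_iff)
      then have "\<rho> (l mod m) = r \<longleftrightarrow> l mod m = the_inv_into {..<m} \<rho> r" for l
        using \<rho> ru(1) unfolding bij_betw_def
        by (metis f_the_inv_into_f lessThan_iff mod_less_divisor the_inv_into_f_f)
      then show ?thesis by (simp add: h_def n_def)
    qed
    also have "card \<dots> = d"
      using \<rho> ru(1) by (intro card_mod_eq_fibre) (metis bij_betwE bij_betw_the_inv_into lessThan_iff)
    finally show ?thesis .
  qed
  moreover have "\<psi> (S x) < Q" if "x \<in> V" for x
    using SE[OF that] \<psi> by (auto simp: bij_betw_def)
  ultimately have "uniform_labelling n q Q d (\<lambda>x. \<psi> (S x))"
    by (auto simp: uniform_labelling_def V_def)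
  then show ?thesis unfolding n_def m Q_def by blast
qed

lemma uniform_labelling_imp_bc_coloring:
  assumes lab: "uniform_labelling n q (b + c) d \<sigma>" and "q > 0" "b > 0" "c > 0" "d > 0"
  shows "has_bc_coloring (d * b) (d * c) q n"
proof -
  define V where "V = hamming_vertices n q"
  define f where "f = (\<lambda>x. if \<sigma> x < c then 1 else 2 :: nat)"
  have \<sigma>: "\<sigma> x < b + c" if "x \<in> V" for x
    using lab that by (auto simp: uniform_labelling_def V_def)
  have fibre: "card {y \<in> V. hamming_adj x y \<and> \<sigma> y = t} = d"
    if "x \<in> V" "t < b + c" "t \<noteq> \<sigma> x" for x t
    using lab that by (simp add: uniform_labelling_def V_def)
  have fibres: "card {y \<in> V. hamming_adj x y \<and> \<sigma> y \<in> T} = d * card T"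
    if x: "x \<in> V" and T: "T \<subseteq> {..<b + c}" "\<sigma> x \<notin> T" for x T
  proof -
    have "{y \<in> V. hamming_adj x y \<and> \<sigma> y \<in> T} = (\<Union>t\<in>T. {y \<in> V. hamming_adj x y \<and> \<sigma> y = t})"
      by auto
    also have "card \<dots> = (\<Sum>t\<in>T. card {y \<in> V. hamming_adj x y \<and> \<sigma> y = t})"
      using T by (intro card_UN_disjoint) (auto simp: V_def finite_subset)
    also have "\<dots> = (\<Sum>t\<in>T. d)"
      using T x by (intro sum.cong refl fibre) auto
    finally show ?thesis by simp
  qed
  have surj: "\<exists>x\<in>V. \<sigma> x = t" if t: "t < b + c" for t
  proof -
    have x: "replicate n 0 \<in> V" using \<open>q > 0\<close> by (auto simp: V_def hamming_vertices_def)
    show ?thesis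
    proof (cases "t = \<sigma> (replicate n 0)")
      case False
      then have "{y \<in> V. hamming_adj (replicate n 0) y \<and> \<sigma> y = t} \<noteq> {}"
        using fibre[OF x t] \<open>d > 0\<close> by (metis card.empty less_not_refl)
      then show ?thesis by auto
    qed (use x in auto)
  qed
  have "bc_coloring (d * b) (d * c) n q f"
    unfolding bc_coloring_def V_def[symmetric]
  proof (intro conjI ballI impI)
    obtain x y where "x \<in> V" "\<sigma> x = 0" "y \<in> V" "\<sigma> y = c"
      using surj[of 0] surj[of c] \<open>b > 0\<close> \<open>c > 0\<close> by auto
    then have "f x = 1" "f y = 2" using \<open>c > 0\<close> by (auto simp: f_def)
    with \<open>x \<in> V\<close> \<open>y \<in> V\<close> have "{1, 2} \<subseteq> f ` V" by (auto intro: rev_image_eqI)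
    then show "f ` V = {1, 2}" by (auto simp: f_def)
  next
    fix x assume x: "x \<in> V" "f x = 1"
    have "{y \<in> V. hamming_adj x y \<and> f y = 2} = {y \<in> V. hamming_adj x y \<and> \<sigma> y \<in> {c..<b + c}}"
      using \<sigma> by (auto simp: f_def)
    moreover have "\<sigma> x < c" using x by (simp add: f_def split: if_splits)
    ultimately show "card {y \<in> V. hamming_adj x y \<and> f y = 2} = d * b"
      using fibres[of x "{c..<b + c}"] x(1) by (simp add: subset_iff)
  next
    fix x assume x: "x \<in> V" "f x = 2"
    have "{y \<in> V. hamming_adj x y \<and> f y = 1} = {y \<in> V. hamming_adj x y \<and> \<sigma> y \<in> {..<c}}"
      by (auto simp: f_def)
    moreover have "\<not> \<sigma> x < c" using x by (simp add: f_def split: if_splits)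
    ultimately show "card {y \<in> V. hamming_adj x y \<and> f y = 1} = d * c"
      using fibres[of x "{..<c}"] x(1) by (simp add: subset_iff)
  qed
  then show ?thesis by (auto simp: has_bc_coloring_def)
qed

definition labelling_prime :: "nat \<Rightarrow> bool" where
  "labelling_prime p \<longleftrightarrow> (\<forall>s>0. \<forall>k>0. \<forall>d. \<exists>\<sigma>.
     uniform_labelling (d * (((p ^ s) ^ k - 1) div (p ^ s - 1))) (p ^ s) ((p ^ s) ^ k) d \<sigma>)"

text \<open>A field of characteristic \<open>p\<close> is needed as a type, but HOL types cannot depend on the
  variable \<open>p\<close>. It suffices to treat one closed term that denotes a counterexample to
  \<open>labelling_prime\<close> if there is one.\<close>

definition critical_prime :: nat where
  "critical_prime = (SOME p. prime p \<and>
     ((\<exists>p'. prime p' \<and> \<not> labelling_prime p') \<longrightarrow> \<not> labelling_prime p))"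

lemma critical_prime:
  "prime critical_prime"
  "prime p \<Longrightarrow> \<not> labelling_prime p \<Longrightarrow> \<not> labelling_prime critical_prime"
proof -
  have "\<exists>p :: nat. prime p \<and> ((\<exists>p'. prime p' \<and> \<not> labelling_prime p') \<longrightarrow> \<not> labelling_prime p)"
    using two_is_prime_nat by metis
  from someI_ex[OF this, folded critical_prime_def]
  show "prime critical_prime"
    "prime p \<Longrightarrow> \<not> labelling_prime p \<Longrightarrow> \<not> labelling_prime critical_prime" by blast+
qed

typedef critical_index = "{..<critical_prime}"
  using prime_gt_0_nat[OF critical_prime(1)] by blast

lemma CARD_critical_index: "CARD(critical_index) = critical_prime"
  using type_definition.card[OF type_definition_critical_index] by simp

instance critical_index :: prime_card
  by standard (simp add: CARD_critical_index critical_prime(1))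

lemma labelling_prime: "prime p \<Longrightarrow> labelling_prime p"
proof -
  have "CHAR(critical_index mod_ring alg_closure) = critical_prime"
    by (simp add: CARD_critical_index)
  then have "labelling_prime critical_prime"
    unfolding labelling_prime_def
    using uniform_labelling_alg_closed_field[where ?'a = "critical_index mod_ring alg_closure"]
      critical_prime(1) by simp
  then show "prime p \<Longrightarrow> labelling_prime p" using critical_prime(2) by blast
qed

theorem theorem9:
  fixes p s q b c k :: nat
  assumes "prime p" and "s \<ge> 1" and "q = p ^ s"
    and "b > 0" and "c > 0" and "k > 0"
    and "b div gcd b c + c div gcd b c = q ^ k"
  shows "admissible b c q \<and>
    max (real b / real (q - 1)) (real (b + c) / real q + real k - 1) \<le> real (threshold b c q) \<and>
    real (threshold b c q) \<le> real (b + c - gcd b c) / real (q - 1)"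
proof -
  have "q > 1"
    unfolding \<open>q = p ^ s\<close> using \<open>s \<ge> 1\<close> prime_gt_1_nat[OF \<open>prime p\<close>] by (intro one_less_power) auto
  define d where "d = gcd b c"
  have "d > 0" using \<open>b > 0\<close> by (simp add: d_def)
  have b: "d * (b div d) = b" and c: "d * (c div d) = c" by (simp_all add: d_def)
  then have pos: "b div d > 0" "c div d > 0"
    using \<open>b > 0\<close> \<open>c > 0\<close> by (metis mult_0_right neq0_conv)+
  have sum: "b div d + c div d = q ^ k" using assms(7) by (simp add: d_def)
  have bc: "b + c = d * q ^ k"
    using b c sum by (metis distrib_left)
  define N where "N = d * ((q ^ k - 1) div (q - 1))"
  obtain \<sigma> where "uniform_labelling N q (b div d + c div d) d \<sigma>"
    using labelling_prime[OF \<open>prime p\<close>] \<open>s \<ge> 1\<close> \<open>k > 0\<close>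
    unfolding labelling_prime_def N_def sum \<open>q = p ^ s\<close> by fastforce
  from uniform_labelling_imp_bc_coloring[OF this] have has: "has_bc_coloring b c q N"
    using \<open>q > 1\<close> pos \<open>d > 0\<close> b c by simp
  define n where "n = threshold b c q"
  have "n \<le> N" unfolding n_def threshold_def using has by (rule Least_le)
  obtain f where f: "bc_coloring b c n q f"
    using LeastI[of "has_bc_coloring b c q", OF has]
    unfolding n_def threshold_def has_bc_coloring_def by blast
  have "(q - 1) dvd (q ^ k - 1)"
  proof (induction k)
    case (Suc j)
    have "q ^ Suc j - 1 = q * (q ^ j - 1) + (q - 1)"
      using \<open>q > 1\<close> by (simp add: diff_mult_distrib2)
    then show ?case using Suc by simp
  qed simp
  then have "N * (q - 1) = b + c - gcd b c"
    unfolding N_def bc d_def[symmetric] mult.assoc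
    by (subst dvd_div_mult_self) (auto simp: diff_mult_distrib2)
  then have "n * (q - 1) \<le> b + c - gcd b c"
    using \<open>n \<le> N\<close> by (metis mult_le_mono1)
  then have "real n \<le> real (b + c - gcd b c) / real (q - 1)"
    using \<open>q > 1\<close> by (simp add: pos_le_divide_eq flip: of_nat_mult del: of_nat_diff)
  moreover have "real b / real (q - 1) \<le> real n"
    using bc_coloring_degree_bound[OF f] \<open>q > 1\<close>
    by (simp add: pos_divide_le_eq flip: of_nat_mult del: of_nat_diff)
  moreover have "real (b + c) / real q + real k - 1 \<le> real n"
  proof -
    define i where "i = d * q ^ (k - 1)"
    have i: "b + c = q * i"
      unfolding bc i_def using \<open>k > 0\<close> by (cases k) simp_all
    have "i > 0" using \<open>d > 0\<close> \<open>q > 1\<close> by (simp add: i_def)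
    then have "i + k \<le> n + 1"
      using bc_coloring_correlation_bound[OF f \<open>q > 1\<close> \<open>b > 0\<close> \<open>c > 0\<close> _ i assms(7)] by simp
    moreover have "real (b + c) / real q = real i" using i \<open>q > 1\<close> by simp
    ultimately show ?thesis by linarith
  qed
  ultimately show ?thesis
    using has by (auto simp: admissible_def n_def)
qed

end
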